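(* Let $(X,d)$ be a complete metric space with $|X|\geq 3$ and let the mapping $T:X\to X$ satisfy the following two conditions: (i) $T(Tx)\neq x$ for all $x\in X$ such that $Tx\neq x$; (ii) $T$ is a generalized Chatterjea type mapping on $X$. Then $T$ has a fixed point, and the number of fixed points of $T$ is at most two.
   Context: Let $(X,d)$ be a metric space with $|X|\geq 3$. A mapping $T:X\to X$ is called a generalized Chatterjea type mapping on $X$ if there exists $\lambda\in[0,\frac12)$ such that the inequality $$d(Tx,Ty)+d(Ty,Tz)+d(Tz,Tx)\leq \lambda\,[d(x,Ty)+d(y,Tx)+d(y,Tz)+d(z,Tx)+d(z,Ty)+d(x,Tz)]$$ holds for all three pairwise distinct points $x,y,z\in X$. Here $Tx$ denotes $T(x)$, and no continuity of $T$ is assumed. *)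

theory Defs
  imports "HOL-Analysis.Abstract_Metric_Spaces"
begin

definition generalized_Chatterjea :: "'a set \<Rightarrow> ('a \<Rightarrow> 'a \<Rightarrow> real) \<Rightarrow> ('a \<Rightarrow> 'a) \<Rightarrow> bool"
  where "generalized_Chatterjea X d T \<longleftrightarrow>
    (\<exists>c::real. 0 \<le> c \<and> c < 1/2 \<and>
      (\<forall>x\<in>X. \<forall>y\<in>X. \<forall>z\<in>X. x \<noteq> y \<and> y \<noteq> z \<and> x \<noteq> z \<longrightarrow>
        d (T x) (T y) + d (T y) (T z) + d (T z) (T x)
          \<le> c * (d x (T y) + d y (T x) + d y (T z) + d z (T x) + d z (T y) + d x (T z))))"

end

(* Along a fixed-point-free orbit x n = T^n a, consecutive triples are pairwise distinct, and the
   perimeter P n of the triangle x n, x (n+1), x (n+2) satisfies P (n+1) <= c/(1-c) * P n, where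
   c/(1-c) < 1.  Hence the orbit is Cauchy, and it is injective because P strictly decreases.
   Injectivity makes x n, x (n+1) and the limit p pairwise distinct for large n; letting n tend to
   infinity in the contraction inequality yields 2 d p (T p) <= 2 c d p (T p), so T p = p.
   Three distinct fixed points would form a triangle of perimeter S > 0 with S <= 2 c S. *)

theory Submission
  imports Defs
begin

text \<open>Summing the steps from \<open>n\<close> on is dominated by the tail of a geometric
  series, \<open>C * k ^ n / (1 - k)\<close>, which does not depend on the number of steps and tends
  to 0.\<close>

lemma (in Metric_space) MCauchy_geometric:
  fixes x :: "nat \<Rightarrow> 'a"
  assumes x: "\<And>n. x n \<in> M" and k: "0 \<le> k" "k < 1"
    and step: "\<And>n. d (x n) (x (Suc n)) \<le> C * k ^ n"
  shows "MCauchy x"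
proof -
  have C: "0 \<le> C" using order_trans[OF nonneg step[of 0]] by simp
  \<comment> \<open>The start \<open>n\<close> stays arbitrary: peeling off the first step leaves a
    path of length \<open>j\<close> from \<open>Suc n\<close>, and \<open>C * k ^ n\<close> is
    exactly what its bound lacks.\<close>
  have bound: "d (x n) (x (n + j)) \<le> C * k ^ n / (1 - k)" for n j
  proof (induction j arbitrary: n)
    case 0
    then show ?case using x k C by simp
  next
    case (Suc j)
    have "d (x n) (x (n + Suc j)) \<le> d (x n) (x (Suc n)) + d (x (Suc n)) (x (Suc n + j))"
      using triangle x by simp
    also have "\<dots> \<le> C * k ^ n + C * k ^ Suc n / (1 - k)"
      using step[of n] Suc.IH[of "Suc n"] by linarith
    also have "\<dots> = C * k ^ n / (1 - k)"
      using k by (simp add: field_simps)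
    finally show ?case .
  qed
  have "\<exists>N. \<forall>n n'. N \<le> n \<longrightarrow> N \<le> n' \<longrightarrow> d (x n) (x n') < e" if "e > 0" for e
  proof -
    have "(\<lambda>n. C / (1 - k) * k ^ n) \<longlonglongrightarrow> C / (1 - k) * 0"
      using k by (intro tendsto_intros LIMSEQ_power_zero) auto
    then have "eventually (\<lambda>n. C / (1 - k) * k ^ n < e) sequentially"
      using that by (intro order_tendstoD(2)) auto
    then obtain N where N: "\<And>n. n \<ge> N \<Longrightarrow> C * k ^ n / (1 - k) < e"
      by (auto simp: eventually_sequentially)
    have *: "d (x n) (x n') < e" if "N \<le> n" "n \<le> n'" for n n'
      using bound[of n "n' - n"] N[of n] that by simp
    have "d (x n) (x n') < e" if "N \<le> n" "N \<le> n'" for n n'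
      using *[of n n'] *[of n' n] that by (cases "n \<le> n'") (auto simp: commute)
    then show ?thesis by blast
  qed
  then show ?thesis
    using x by (auto simp: MCauchy_def)
qed

theorem theorem2p1:
  fixes X :: "'a set" and d :: "'a \<Rightarrow> 'a \<Rightarrow> real" and T :: "'a \<Rightarrow> 'a"
  assumes "Metric_space X d"
    and "Metric_space.mcomplete X d"
    and "infinite X \<or> card X \<ge> 3"
    and "T \<in> X \<rightarrow> X"
    and "\<forall>x\<in>X. T x \<noteq> x \<longrightarrow> T (T x) \<noteq> x"
    and "generalized_Chatterjea X d T"
  shows "(\<exists>x\<in>X. T x = x) \<and> finite {x\<in>X. T x = x} \<and> card {x\<in>X. T x = x} \<le> 2"
proof -
  interpret Metric_space X d by fact
  from assms(6) obtain c where c: "0 \<le> c" "c < 1/2"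
    and contraction: "\<forall>x\<in>X. \<forall>y\<in>X. \<forall>z\<in>X. x \<noteq> y \<and> y \<noteq> z \<and> x \<noteq> z \<longrightarrow>
      d (T x) (T y) + d (T y) (T z) + d (T z) (T x)
        \<le> c * (d x (T y) + d y (T x) + d y (T z) + d z (T x) + d z (T y) + d x (T z))"
    unfolding generalized_Chatterjea_def by (elim exE conjE)
  have gc: "d (T x) (T y) + d (T y) (T z) + d (T z) (T x)
        \<le> c * (d x (T y) + d y (T x) + d y (T z) + d z (T x) + d z (T y) + d x (T z))"
    if "x \<in> X" "y \<in> X" "z \<in> X" "x \<noteq> y" "y \<noteq> z" "x \<noteq> z" for x y z
    using contraction that by blast
  have fixed_point: "\<exists>x\<in>X. T x = x"
  proof (rule ccontr)
    assume "\<not> ?thesis"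
    then have nofix: "\<And>x. x \<in> X \<Longrightarrow> T x \<noteq> x" by blast
    have "X \<noteq> {}" using assms(3) by auto
    then obtain a where a: "a \<in> X" by blast
    define x where "x n = (T ^^ n) a" for n
    have Tx: "T (x n) = x (Suc n)" for n by (simp add: x_def)
    have xX: "x n \<in> X" for n
      by (induction n) (use a assms(4) in \<open>auto simp: x_def\<close>)
    \<comment> \<open>\<open>ne1\<close> is the absence of fixed points; \<open>ne2\<close> is
      condition (i), which rules out 2-cycles.\<close>
    have ne1: "x n \<noteq> x (Suc n)" and ne2: "x n \<noteq> x (Suc (Suc n))" for n
      using nofix[OF xX[of n]] bspec[OF assms(5) xX[of n]] by (simp_all add: Tx eq_commute)
    define P where
      "P n = d (x n) (x (Suc n)) + d (x (Suc n)) (x (Suc (Suc n))) + d (x n) (x (Suc (Suc n)))" for n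
    \<comment> \<open>This ratio comes from solving
      \<open>P (Suc n) \<le> c * (P n + P (Suc n))\<close> for \<open>P (Suc n)\<close>; it is below
      1 because \<open>c < 1/2\<close>.\<close>
    define k where "k = c / (1 - c)"
    have k: "0 \<le> k" "k < 1" using c by (auto simp: k_def field_simps)
    have P_pos: "P n > 0" and a_le: "d (x n) (x (Suc n)) \<le> P n" for n
    proof -
      have "d (x n) (x (Suc n)) > 0" using xX ne1 by simp
      moreover have "0 \<le> d (x (Suc n)) (x (Suc (Suc n)))" "0 \<le> d (x n) (x (Suc (Suc n)))" by simp_all
      ultimately show "P n > 0" and "d (x n) (x (Suc n)) \<le> P n" unfolding P_def by linarith+
    qed
    have P_step: "P (Suc n) \<le> k * P n" for n
    proof -
      let ?x0 = "x n" and ?x1 = "x (Suc n)" and ?x2 = "x (Suc (Suc n))" and ?x3 = "x (Suc (Suc (Suc n)))"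
      \<comment> \<open>Two of the six cross distances vanish, being of the form
        \<open>d ?x1 ?x1\<close> and \<open>d ?x2 ?x2\<close>.\<close>
      have "P (Suc n) \<le> c * (d ?x0 ?x2 + d ?x1 ?x3 + d ?x1 ?x2 + d ?x0 ?x3)"
        using gc[OF xX[of n] xX[of "Suc n"] xX[of "Suc (Suc n)"] ne1 ne1 ne2] xX
        by (simp add: Tx P_def commute algebra_simps)
      also have "\<dots> \<le> c * (P n + P (Suc n))"
      proof (rule mult_left_mono)
        \<comment> \<open>Splitting \<open>d ?x0 ?x3\<close> at \<open>?x2\<close> yields a second
          copy of \<open>d ?x0 ?x2\<close>; one copy is a side in \<open>P n\<close>, the other is
          split at \<open>?x1\<close>.\<close>
        have "d ?x0 ?x3 \<le> d ?x0 ?x2 + d ?x2 ?x3" "d ?x0 ?x2 \<le> d ?x0 ?x1 + d ?x1 ?x2"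
          using triangle xX by blast+
        then show "d ?x0 ?x2 + d ?x1 ?x3 + d ?x1 ?x2 + d ?x0 ?x3 \<le> P n + P (Suc n)"
          unfolding P_def by linarith
      qed (use c in simp)
      finally show ?thesis using c by (simp add: k_def field_simps)
    qed
    have "P (Suc n) < P n" for n
      using P_step[of n] mult_strict_right_mono[OF k(2) P_pos[of n]] by simp
    then have inj: "m = n" if "x m = x n" for m n
    proof -
      \<comment> \<open>\<open>x n\<close> determines all later iterates, hence
        \<open>P n\<close>.\<close>
      have "P m = P n" using that by (simp add: P_def flip: Tx)
      moreover have "P j < P i" if "i < j" for i j
        using lift_Suc_mono_less[of "\<lambda>n. - P n" i j] \<open>\<And>n. P (Suc n) < P n\<close> that by simp
      ultimately show ?thesis by (metis less_irrefl linorder_neqE_nat)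
    qed
    have "P n \<le> P 0 * k ^ n" for n
    proof (induction n)
      case (Suc n)
      then show ?case
        using P_step[of n] mult_left_mono[OF Suc k(1)] by (simp add: mult.left_commute)
    qed simp
    then have "d (x n) (x (Suc n)) \<le> P 0 * k ^ n" for n
      using a_le order_trans by blast
    then have "MCauchy x" using MCauchy_geometric[of x k "P 0"] xX k by blast
    then obtain p where lim: "limitin mtopology x p sequentially"
      using assms(2) unfolding mcomplete_def by blast
    have p: "p \<in> X" using lim by (simp add: limitin_metric)
    have Tp: "T p \<in> X" using p assms(4) by auto
    define D where "D = d p (T p)"
    have D: "D > 0" using p Tp nofix[OF p] by (auto simp: D_def)
    \<comment> \<open>The upper estimate below collects six errors of size \<open>D / 6\<close> on
      top of \<open>2 * D\<close>, for a total of \<open>3 * D\<close>.\<close>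
    then obtain N where N: "\<And>n. n \<ge> N \<Longrightarrow> d (x n) p < D / 6"
      using lim unfolding limitin_metric eventually_sequentially
      by (metis divide_pos_pos zero_less_numeral)
    \<comment> \<open>An injective orbit meets \<open>p\<close> at most once, so it suffices to go
      past that index.\<close>
    obtain n where n: "n \<ge> N" "x n \<noteq> p" "x (Suc n) \<noteq> p"
    proof (cases "\<exists>m. x m = p")
      case True
      then obtain m where m: "x m = p" by blast
      have "x j \<noteq> p" if "j > m" for j using inj[of j m] m that by auto
      then show ?thesis using that[of "Suc (max N m)"] by auto
    next
      case False
      then show ?thesis using that[of N] by auto
    qed
    let ?x0 = "x n" and ?x1 = "x (Suc n)" and ?x2 = "x (Suc (Suc n))"
    have e: "d ?x0 p < D / 6" "d ?x1 p < D / 6" "d ?x2 p < D / 6"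
      using N n(1) by auto
    have "d ?x1 ?x2 + d ?x2 (T p) + d ?x1 (T p)
        \<le> c * (d ?x0 ?x2 + d ?x1 (T p) + d ?x1 p + d ?x2 p + d ?x0 (T p))"
      using gc[OF xX[of n] xX[of "Suc n"] p ne1 n(3) n(2)] xX
      by (simp add: Tx commute)
    also have "\<dots> \<le> c * (3 * D)"
    proof (rule mult_left_mono)
      have "d ?x0 ?x2 \<le> d ?x0 p + d ?x2 p" "d ?x1 (T p) \<le> d ?x1 p + D" "d ?x0 (T p) \<le> d ?x0 p + D"
        unfolding D_def using triangle triangle' xX p Tp by blast+
      then show "d ?x0 ?x2 + d ?x1 (T p) + d ?x1 p + d ?x2 p + d ?x0 (T p) \<le> 3 * D"
        using e by linarith
    qed (use c in simp)
    also have "\<dots> < 3 / 2 * D" using c D by simp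
    finally have "d ?x1 ?x2 + d ?x2 (T p) + d ?x1 (T p) < 3 / 2 * D" .
    \<comment> \<open>These give a lower bound above \<open>2 * D - 2 * (D / 6) = 5/3 * D\<close>
      for the left-hand side, which exceeds \<open>3 / 2 * D\<close>.\<close>
    moreover have "D \<le> d ?x1 p + d ?x1 (T p)" "D \<le> d ?x2 p + d ?x2 (T p)"
      unfolding D_def using triangle'' xX p Tp by blast+
    moreover have "0 \<le> d ?x1 ?x2" by simp
    ultimately show False using e D by linarith
  qed
  let ?F = "{x\<in>X. T x = x}"
  have "finite ?F \<and> card ?F \<le> 2"
  proof (rule ccontr)
    assume "\<not> ?thesis"
    then have "infinite ?F \<or> 3 \<le> card ?F" by linarith
    then have "\<exists>A. A \<subseteq> ?F \<and> card A = 3"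
      using infinite_arbitrarily_large[of ?F 3] obtain_subset_with_card_n[of 3 ?F] by blast
    then obtain A where "A \<subseteq> ?F" "card A = 3" by blast
    then obtain x y z where xyz: "x \<in> ?F" "y \<in> ?F" "z \<in> ?F" "x \<noteq> y" "y \<noteq> z" "x \<noteq> z"
      by (auto simp: card_3_iff)
    define S where "S = d x y + d y z + d z x"
    have "S > 0" using xyz by (auto simp: S_def intro!: add_pos_pos)
    \<comment> \<open>At fixed points the six cross distances are the three sides, each counted
      twice.\<close>
    have "S \<le> c * (2 * S)"
      using gc[of x y z] xyz by (simp add: S_def commute algebra_simps)
    moreover have "c * (2 * S) < S" using c \<open>S > 0\<close> by simp
    ultimately show False by simp
  qed
  with fixed_point show ?thesis by blast
qed

end
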